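(* Let $W=M_uC_\varphi$ be a bounded weighted composition operator with closed range on $L^2(\mu)$, and let $J=hE(|u|^2)\circ\varphi^{-1}$. Then $W$ is $\lambda$-hyponormal for some $\lambda>0$ if and only if $S(u)\subseteq S(J)$.
   Context: $(X,\mathcal{F},\mu)$ is a $\sigma$-finite measure space, $L^2(\mu)$ is the complex $L^2$ space, $\varphi:X\to X$ is a non-singular measurable transformation (i.e. $\mu\circ\varphi^{-1}\ll\mu$), and $u:X\to[0,\infty)$ is measurable. The weighted composition operator is $Wf=M_uC_\varphi f=u\cdot(f\circ\varphi)$. Here $h=\frac{d\mu\circ\varphi^{-1}}{d\mu}$ is the Radon-Nikodym derivative and $E$ is the conditional expectation with respect to the $\sigma$-subalgebra $\varphi^{-1}(\mathcal{F})$. Since $E(f)$ has the form $g\circ\varphi$ with $g$ $\mathcal{F}$-measurable and determined a.e. on $\{h\neq0\}$, $hE(f)\circ\varphi^{-1}$ denotes the function $h\cdot g$. Thus $J=hE(|u|^2)\circ\varphi^{-1}$ is the ($\mu$-a.e. unique) nonnegative measurable function with $\int_A J\,d\mu=\int_{\varphi^{-1}(A)}|u|^2\,d\mu$ for all $A\in\mathcal{F}$. For a measurable function $f$, $S(f)=\{x\in X: f(x)\neq0\}$ is its support; inclusions of such sets are understood up to $\mu$-null sets. For $\lambda>0$, a bounded operator $T$ on a Hilbert space is $\lambda$-hyponormal if $T^*T\geq\frac{1}{\lambda}TT^*$. *)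

theory Defs
  imports "HOL-Probability.Conditional_Expectation"
begin

section \<open>The complex space L2 of a measure and its operators\<close>

text \<open>
  Elements of the complex Hilbert space are represented by square-integrable functions, and
  equality of elements is equality almost everywhere. An operator is a map on representatives
  that respects this equality on square-integrable functions; its values on other functions
  are irrelevant.
\<close>

definition L2 :: "'a measure \<Rightarrow> ('a \<Rightarrow> complex) set" where
  "L2 M = {f. f \<in> borel_measurable M \<and> integrable M (\<lambda>x. (cmod (f x))\<^sup>2)}"

definition L2_inner :: "'a measure \<Rightarrow> ('a \<Rightarrow> complex) \<Rightarrow> ('a \<Rightarrow> complex) \<Rightarrow> complex" where
  "L2_inner M f g = (\<integral>x. f x * cnj (g x) \<partial>M)"

definition L2_norm :: "'a measure \<Rightarrow> ('a \<Rightarrow> complex) \<Rightarrow> real" where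
  "L2_norm M f = sqrt (\<integral>x. (cmod (f x))\<^sup>2 \<partial>M)"

definition L2_bounded_operator ::
    "'a measure \<Rightarrow> (('a \<Rightarrow> complex) \<Rightarrow> 'a \<Rightarrow> complex) \<Rightarrow> bool" where
  "L2_bounded_operator M T \<longleftrightarrow>
     (\<forall>f\<in>L2 M. T f \<in> L2 M) \<and>
     (\<forall>f\<in>L2 M. \<forall>g\<in>L2 M. (AE x in M. f x = g x) \<longrightarrow> (AE x in M. T f x = T g x)) \<and>
     (\<forall>f\<in>L2 M. \<forall>g\<in>L2 M. AE x in M. T (\<lambda>y. f y + g y) x = T f x + T g x) \<and>
     (\<forall>c. \<forall>f\<in>L2 M. AE x in M. T (\<lambda>y. c * f y) x = c * T f x) \<and>
     (\<exists>C. \<forall>f\<in>L2 M. L2_norm M (T f) \<le> C * L2_norm M f)"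

definition L2_closed_range ::
    "'a measure \<Rightarrow> (('a \<Rightarrow> complex) \<Rightarrow> 'a \<Rightarrow> complex) \<Rightarrow> bool" where
  "L2_closed_range M T \<longleftrightarrow>
     (\<forall>F g. (\<forall>n::nat. F n \<in> L2 M) \<longrightarrow> g \<in> L2 M \<longrightarrow>
        (\<lambda>n. L2_norm M (\<lambda>x. T (F n) x - g x)) \<longlonglongrightarrow> 0 \<longrightarrow>
        (\<exists>f\<in>L2 M. AE x in M. T f x = g x))"

definition L2_is_adjoint ::
    "'a measure \<Rightarrow> (('a \<Rightarrow> complex) \<Rightarrow> 'a \<Rightarrow> complex) \<Rightarrow>
     (('a \<Rightarrow> complex) \<Rightarrow> 'a \<Rightarrow> complex) \<Rightarrow> bool" where
  "L2_is_adjoint M T S \<longleftrightarrow>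
     (\<forall>f\<in>L2 M. S f \<in> L2 M) \<and>
     (\<forall>f\<in>L2 M. \<forall>g\<in>L2 M. L2_inner M (T f) g = L2_inner M f (S g))"

definition L2_positive ::
    "'a measure \<Rightarrow> (('a \<Rightarrow> complex) \<Rightarrow> 'a \<Rightarrow> complex) \<Rightarrow> bool" where
  "L2_positive M A \<longleftrightarrow> (\<forall>f\<in>L2 M. L2_inner M (A f) f \<in> \<real>\<^sub>\<ge>\<^sub>0)"

definition L2_operator_le ::
    "'a measure \<Rightarrow> (('a \<Rightarrow> complex) \<Rightarrow> 'a \<Rightarrow> complex) \<Rightarrow>
     (('a \<Rightarrow> complex) \<Rightarrow> 'a \<Rightarrow> complex) \<Rightarrow> bool" where
  "L2_operator_le M A B \<longleftrightarrow> L2_positive M (\<lambda>f x. B f x - A f x)"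

text \<open>
  The adjoint is unique up to equality almost everywhere, so the choice of \<open>S\<close> below is immaterial.
\<close>

definition lambda_hyponormal ::
    "'a measure \<Rightarrow> real \<Rightarrow> (('a \<Rightarrow> complex) \<Rightarrow> 'a \<Rightarrow> complex) \<Rightarrow> bool" where
  "lambda_hyponormal M l T \<longleftrightarrow>
     (\<exists>S. L2_is_adjoint M T S \<and>
        L2_operator_le M (\<lambda>f x. complex_of_real (1 / l) * T (S f) x) (\<lambda>f. S (T f)))"


section \<open>Weighted composition operators\<close>

definition nonsingular :: "'a measure \<Rightarrow> ('a \<Rightarrow> 'a) \<Rightarrow> bool" where
  "nonsingular M \<phi> \<longleftrightarrow> \<phi> \<in> measurable M M \<and> absolutely_continuous M (distr M M \<phi>)"

definition wcomp :: "('a \<Rightarrow> real) \<Rightarrow> ('a \<Rightarrow> 'a) \<Rightarrow> ('a \<Rightarrow> complex) \<Rightarrow> 'a \<Rightarrow> complex" where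
  "wcomp u \<phi> f = (\<lambda>x. complex_of_real (u x) * f (\<phi> x))"

definition supp :: "'a measure \<Rightarrow> ('a \<Rightarrow> 'b::zero) \<Rightarrow> 'a set" where
  "supp M f = {x \<in> space M. f x \<noteq> 0}"

definition AE_subset :: "'a measure \<Rightarrow> 'a set \<Rightarrow> 'a set \<Rightarrow> bool" where
  "AE_subset M A B \<longleftrightarrow> (AE x in M. x \<in> A \<longrightarrow> x \<in> B)"

text \<open>
  \<open>is_hE M \<phi> f J\<close> says that \<open>J\<close> is a version of the function written
  $h E(f)\circ\varphi^{-1}$, for nonnegative measurable \<open>f\<close>. It is expressed by the defining
  integral identity, which makes sense even when \<open>M\<close> is not sigma-finite on the sigma-algebra
  $\varphi^{-1}(\mathcal F)$, where the conditional expectation \<open>E\<close> need not exist. The lemmas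
  after it show that such \<open>J\<close> exists, is unique almost everywhere, and is $h \cdot g$ with
  $E(f) = g\circ\varphi$ whenever \<open>M\<close> is sigma-finite on that sigma-algebra.
\<close>

definition is_hE ::
    "'a measure \<Rightarrow> ('a \<Rightarrow> 'a) \<Rightarrow> ('a \<Rightarrow> ennreal) \<Rightarrow> ('a \<Rightarrow> ennreal) \<Rightarrow> bool" where
  "is_hE M \<phi> f J \<longleftrightarrow>
     J \<in> borel_measurable M \<and>
     (\<forall>A\<in>sets M. (\<integral>\<^sup>+x\<in>A. J x \<partial>M) = (\<integral>\<^sup>+x\<in>(\<phi> -` A \<inter> space M). f x \<partial>M))"

definition RN_h :: "'a measure \<Rightarrow> ('a \<Rightarrow> 'a) \<Rightarrow> 'a \<Rightarrow> ennreal" where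
  "RN_h M \<phi> = RN_deriv M (distr M M \<phi>)"

definition cond_E :: "'a measure \<Rightarrow> ('a \<Rightarrow> 'a) \<Rightarrow> ('a \<Rightarrow> ennreal) \<Rightarrow> 'a \<Rightarrow> ennreal" where
  "cond_E M \<phi> f = nn_cond_exp M (vimage_algebra (space M) \<phi> M) f"

lemma is_hE_iff_density:
  assumes [measurable]: "\<phi> \<in> measurable M M" "f \<in> borel_measurable M"
  shows "is_hE M \<phi> f J \<longleftrightarrow>
           J \<in> borel_measurable M \<and> density M J = distr (density M f) M \<phi>"
proof -
  have m: "\<phi> \<in> measurable (density M f) M" by simp
  have *: "emeasure (distr (density M f) M \<phi>) A = (\<integral>\<^sup>+x\<in>(\<phi> -` A \<inter> space M). f x \<partial>M)"
    if [measurable]: "A \<in> sets M" for A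
    by (subst emeasure_distr[OF m]) (simp_all add: emeasure_density)
  show ?thesis
  proof (cases "J \<in> borel_measurable M")
    case True
    then have d: "emeasure (density M J) A = (\<integral>\<^sup>+x\<in>A. J x \<partial>M)" if "A \<in> sets M" for A
      using that by (rule emeasure_density)
    have "(density M J = distr (density M f) M \<phi>) \<longleftrightarrow>
        (\<forall>A\<in>sets M. emeasure (density M J) A = emeasure (distr (density M f) M \<phi>) A)"
      by (rule iffI, simp, rule measure_eqI, simp_all)
    also have "\<dots> \<longleftrightarrow> (\<forall>A\<in>sets M. (\<integral>\<^sup>+x\<in>A. J x \<partial>M) = (\<integral>\<^sup>+x\<in>(\<phi> -` A \<inter> space M). f x \<partial>M))"
      by (intro ball_cong refl) (simp only: d *)
    finally show ?thesis using True by (simp only: is_hE_def simp_thms)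
  next
    case False
    then show ?thesis by (simp only: is_hE_def simp_thms)
  qed
qed

lemma is_hE_exists:
  assumes "sigma_finite_measure M" "nonsingular M \<phi>" and [measurable]: "f \<in> borel_measurable M"
  shows "\<exists>J. is_hE M \<phi> f J"
proof -
  interpret sigma_finite_measure M by fact
  have [measurable]: "\<phi> \<in> measurable M M" and ac: "absolutely_continuous M (distr M M \<phi>)"
    using assms(2) by (auto simp: nonsingular_def)
  have m: "\<phi> \<in> measurable (density M f) M" by simp
  have "absolutely_continuous M (distr (density M f) M \<phi>)"
    unfolding absolutely_continuous_def
  proof
    fix A assume A: "A \<in> null_sets M"
    then have "A \<in> null_sets (distr M M \<phi>)" using ac by (auto simp: absolutely_continuous_def)
    then have "\<phi> -` A \<inter> space M \<in> null_sets M" by (simp add: null_sets_distr_iff)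
    then have "\<phi> -` A \<inter> space M \<in> null_sets (density M f)"
      using absolutely_continuousI_density[of f M] by (auto simp: absolutely_continuous_def)
    then show "A \<in> null_sets (distr (density M f) M \<phi>)"
      using A by (auto simp: null_sets_distr_iff[OF m])
  qed
  then have "density M (RN_deriv M (distr (density M f) M \<phi>)) = distr (density M f) M \<phi>"
    by (intro density_RN_deriv) auto
  then show ?thesis
    by (intro exI[of _ "RN_deriv M (distr (density M f) M \<phi>)"]) (simp add: is_hE_iff_density)
qed

lemma is_hE_unique:
  assumes "sigma_finite_measure M" "nonsingular M \<phi>" "f \<in> borel_measurable M"
    and "is_hE M \<phi> f J" "is_hE M \<phi> f J'"
  shows "AE x in M. J x = J' x"
proof -
  interpret sigma_finite_measure M by fact
  have "\<phi> \<in> measurable M M" using assms(2) by (auto simp: nonsingular_def)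
  then show ?thesis
    using assms by (intro density_unique) (auto simp: is_hE_iff_density)
qed

lemma is_hE_RN_h_cond_E:
  assumes sf: "sigma_finite_subalgebra M (vimage_algebra (space M) \<phi> M)"
    and ns: "nonsingular M \<phi>"
    and [measurable]: "f \<in> borel_measurable M" "g \<in> borel_measurable M"
    and g: "AE x in M. cond_E M \<phi> f x = g (\<phi> x)"
  shows "is_hE M \<phi> f (\<lambda>x. RN_h M \<phi> x * g x)"
proof -
  let ?F = "vimage_algebra (space M) \<phi> M"
  interpret sigma_finite_subalgebra M ?F by fact
  have [measurable]: "\<phi> \<in> measurable M M" and ac: "absolutely_continuous M (distr M M \<phi>)"
    using ns by (auto simp: nonsingular_def)
  have "(\<integral>\<^sup>+x\<in>A. (RN_h M \<phi> x * g x) \<partial>M) = (\<integral>\<^sup>+x\<in>(\<phi> -` A \<inter> space M). f x \<partial>M)"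
    if [measurable]: "A \<in> sets M" for A
  proof -
    let ?B = "\<phi> -` A \<inter> space M"
    have B: "?B \<in> sets ?F" by (rule in_vimage_algebra) fact
    have "(\<integral>\<^sup>+x\<in>A. (RN_h M \<phi> x * g x) \<partial>M) = (\<integral>\<^sup>+x. g x * indicator A x \<partial>distr M M \<phi>)"
      unfolding RN_h_def by (subst RN_deriv_nn_integral[OF ac]) (auto simp: mult.assoc)
    also have "\<dots> = (\<integral>\<^sup>+x. g (\<phi> x) * indicator A (\<phi> x) \<partial>M)"
      by (rule nn_integral_distr) auto
    also have "\<dots> = (\<integral>\<^sup>+x. indicator ?B x * nn_cond_exp M ?F f x \<partial>M)"
      using g by (intro nn_integral_cong_AE) (auto simp: cond_E_def indicator_def)
    also have "\<dots> = (\<integral>\<^sup>+x. indicator ?B x * f x \<partial>M)"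
      using B by (intro nn_cond_exp_intg) auto
    finally show ?thesis by (simp add: mult.commute)
  qed
  then show ?thesis by (auto simp: is_hE_def RN_h_def)
qed

end

theory Submission
  imports Defs
begin

text \<open>
  Write \<open>W\<close> for the operator and \<open>W*\<close> for its adjoint. The defining property of \<open>J\<close> says that the
  squared norm of \<open>W f\<close> is the integral of \<open>J |f|\<^sup>2\<close>, and \<open>\<lambda>\<close>-hyponormality says that
  \<open>\<parallel>W* f\<parallel>\<^sup>2 \<le> \<lambda> \<parallel>W f\<parallel>\<^sup>2\<close> for all \<open>f\<close> (\<open>L2_operator_le_iff_norm_le\<close>).

  If this holds and \<open>f\<close> is supported where \<open>J = 0\<close>, then \<open>W f = 0\<close>, hence \<open>W* f = 0\<close>, and \<open>f\<close> is
  orthogonal to the range of \<open>W\<close>. For positive \<open>f\<close> and positive elements of the range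
  this forces \<open>u = 0\<close> where \<open>J = 0\<close> (\<open>wcomp_hyponormal_imp_AE_subset\<close>).

  Conversely, closedness of the range gives \<open>c > 0\<close> with \<open>J \<ge> c\<close> on the support of \<open>J\<close>
  (\<open>wcomp_closed_range_bounded_below\<close>): otherwise some \<open>f\<close>, not square-integrable but vanishing
  where \<open>J\<close> does, has a square-integrable image \<open>u \<cdot> (f \<circ> \<phi>)\<close>, which lies in the closure of the
  range but not in the range. As functions in the range of \<open>W\<close> vanish off the support of \<open>u\<close>, for
  \<open>f'\<close> the restriction of \<open>f\<close> to that support
  \[ \|W^* f\|^2 = \langle W W^* f, f' \rangle \le \|W\| \, \|W^* f\| \, \|f'\|, \]
  and if the support of \<open>u\<close> lies in that of \<open>J\<close>, then \<open>c \<parallel>f'\<parallel>\<^sup>2 \<le> \<parallel>W f\<parallel>\<^sup>2\<close>.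

  The adjoint itself is constructed by Radon-Nikodym derivatives (\<open>wcomp_adjoint_exists\<close>): on
  nonnegative functions it is $f \mapsto h E(u f)\circ\varphi^{-1}$.
\<close>

section \<open>Complex square-integrable functions\<close>

lemma L2_measurable: "f \<in> L2 M \<Longrightarrow> f \<in> borel_measurable M"
  by (simp add: L2_def)

lemma L2_iff_nn_integral:
  "f \<in> L2 M \<longleftrightarrow> f \<in> borel_measurable M \<and> (\<integral>\<^sup>+x. ennreal ((cmod (f x))\<^sup>2) \<partial>M) < \<infinity>"
  by (auto simp: L2_def integrable_iff_bounded)

lemma L2_norm_nonneg [simp]: "0 \<le> L2_norm M f"
  by (simp add: L2_norm_def)

lemma L2_norm_sq: "(L2_norm M f)\<^sup>2 = (\<integral>x. (cmod (f x))\<^sup>2 \<partial>M)"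
  by (simp add: L2_norm_def)

lemma ennreal_L2_norm_sq:
  "f \<in> L2 M \<Longrightarrow> ennreal ((L2_norm M f)\<^sup>2) = (\<integral>\<^sup>+x. ennreal ((cmod (f x))\<^sup>2) \<partial>M)"
  by (simp add: L2_norm_sq nn_integral_eq_integral L2_def)

lemma L2_dominated:
  assumes "g \<in> L2 M" "f \<in> borel_measurable M" "\<And>x. x \<in> space M \<Longrightarrow> cmod (f x) \<le> cmod (g x)"
  shows "f \<in> L2 M"
  unfolding L2_def
proof (safe intro!: assms)
  have [measurable]: "f \<in> borel_measurable M" by fact
  show "integrable M (\<lambda>x. (cmod (f x))\<^sup>2)"
    by (rule Bochner_Integration.integrable_bound[of M "\<lambda>x. (cmod (g x))\<^sup>2"])
      (use assms in \<open>auto simp: L2_def intro!: power_mono\<close>)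
qed

lemma L2_add:
  assumes "f \<in> L2 M" "g \<in> L2 M"
  shows "(\<lambda>x. f x + g x) \<in> L2 M"
proof -
  have [measurable]: "f \<in> borel_measurable M" "g \<in> borel_measurable M"
    using assms by (auto intro: L2_measurable)
  have "integrable M (\<lambda>x. (cmod (f x + g x))\<^sup>2)"
  proof (rule Bochner_Integration.integrable_bound[of M "\<lambda>x. 2 * (cmod (f x))\<^sup>2 + 2 * (cmod (g x))\<^sup>2"])
    have "(cmod (f x + g x))\<^sup>2 \<le> 2 * (cmod (f x))\<^sup>2 + 2 * (cmod (g x))\<^sup>2" for x
    proof -
      have "(cmod (f x + g x))\<^sup>2 \<le> (cmod (f x) + cmod (g x))\<^sup>2"
        by (intro power_mono norm_triangle_ineq) auto
      also have "\<dots> \<le> 2 * (cmod (f x))\<^sup>2 + 2 * (cmod (g x))\<^sup>2"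
        using sum_squares_bound[of "cmod (f x)" "cmod (g x)"] by (simp add: power2_sum)
      finally show ?thesis .
    qed
    then show "AE x in M. norm ((cmod (f x + g x))\<^sup>2) \<le> norm (2 * (cmod (f x))\<^sup>2 + 2 * (cmod (g x))\<^sup>2)"
      by auto
  qed (use assms in \<open>auto simp: L2_def\<close>)
  then show ?thesis by (simp add: L2_def)
qed

lemma L2_scale:
  assumes "f \<in> L2 M"
  shows "(\<lambda>x. c * f x) \<in> L2 M"
  using assms by (auto simp: L2_def norm_mult power_mult_distrib)

lemma L2_product_integrable:
  assumes "f \<in> L2 M" "g \<in> L2 M"
  shows "integrable M (\<lambda>x. f x * cnj (g x))"
proof (rule Bochner_Integration.integrable_bound[of M "\<lambda>x. (cmod (f x))\<^sup>2 + (cmod (g x))\<^sup>2"])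
  have "cnj \<in> borel_measurable borel"
    by (intro borel_measurable_continuous_onI continuous_intros)
  then show "(\<lambda>x. f x * cnj (g x)) \<in> borel_measurable M"
    using assms by (auto simp: L2_def intro: measurable_compose)
  have "cmod (f x) * cmod (g x) \<le> (cmod (f x))\<^sup>2 + (cmod (g x))\<^sup>2" for x
    using sum_squares_bound[of "cmod (f x)" "cmod (g x)"]
      mult_nonneg_nonneg[OF norm_ge_zero norm_ge_zero, of "f x" "g x"] by linarith
  then show "AE x in M. norm (f x * cnj (g x)) \<le> norm ((cmod (f x))\<^sup>2 + (cmod (g x))\<^sup>2)"
    by (simp add: norm_mult)
qed (use assms in \<open>auto simp: L2_def\<close>)

lemma L2_inner_self: "L2_inner M f f = complex_of_real ((L2_norm M f)\<^sup>2)"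
  by (simp add: L2_inner_def L2_norm_sq complex_norm_square [symmetric] del: of_real_power)

lemma L2_inner_cnj: "L2_inner M g f = cnj (L2_inner M f g)"
  unfolding L2_inner_def
  by (subst Bochner_Integration.integral_cnj[symmetric]) (simp add: mult.commute)

lemma L2_inner_add_right:
  assumes "f \<in> L2 M" "g \<in> L2 M" "h \<in> L2 M"
  shows "L2_inner M f (\<lambda>x. g x + h x) = L2_inner M f g + L2_inner M f h"
  using assms by (simp add: L2_inner_def distrib_left L2_product_integrable)

lemma L2_inner_diff_left:
  assumes "f \<in> L2 M" "g \<in> L2 M" "h \<in> L2 M"
  shows "L2_inner M (\<lambda>x. g x - h x) f = L2_inner M g f - L2_inner M h f"
  using assms by (simp add: L2_inner_def left_diff_distrib L2_product_integrable)

lemma L2_inner_scale_left: "L2_inner M (\<lambda>x. c * g x) f = c * L2_inner M g f"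
  by (simp add: L2_inner_def mult.assoc)

lemma L2_inner_scale_right: "L2_inner M g (\<lambda>x. c * f x) = cnj c * L2_inner M g f"
  by (simp add: L2_inner_def mult.left_commute)

lemma L2_Cauchy_Schwarz_nn_integral:
  assumes f: "f \<in> L2 M" and g: "g \<in> L2 M"
  shows "(\<integral>\<^sup>+x. ennreal (cmod (f x) * cmod (g x)) \<partial>M) \<le> ennreal (L2_norm M f * L2_norm M g)"
proof -
  have [measurable]: "f \<in> borel_measurable M" "g \<in> borel_measurable M"
    using assms by (auto intro: L2_measurable)
  define r where "r = (\<integral>x. cmod (f x) * cmod (g x) \<partial>M)"
  have r: "(\<integral>\<^sup>+x. ennreal (cmod (f x) * cmod (g x)) \<partial>M) = ennreal r"
    unfolding r_def
    using integrable_norm[OF L2_product_integrable[OF f g]]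
    by (intro nn_integral_eq_integral) (auto simp: norm_mult)
  have "(ennreal r)\<^sup>2 = (\<integral>\<^sup>+x. ennreal (cmod (f x)) * ennreal (cmod (g x)) \<partial>M)\<^sup>2"
    by (simp add: r[symmetric] ennreal_mult)
  also have "\<dots> \<le> (\<integral>\<^sup>+x. (ennreal (cmod (f x)))\<^sup>2 \<partial>M) * (\<integral>\<^sup>+x. (ennreal (cmod (g x)))\<^sup>2 \<partial>M)"
    by (intro Cauchy_Schwarz_nn_integral) auto
  also have "\<dots> = ennreal ((L2_norm M f)\<^sup>2) * ennreal ((L2_norm M g)\<^sup>2)"
    by (simp add: ennreal_L2_norm_sq f g ennreal_power)
  finally have "r\<^sup>2 \<le> (L2_norm M f * L2_norm M g)\<^sup>2"
    by (simp add: r_def ennreal_power ennreal_mult[symmetric] power_mult_distrib)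
  then have "r \<le> L2_norm M f * L2_norm M g"
    by (rule power2_le_imp_le) simp
  then show ?thesis by (simp add: r ennreal_leI)
qed

lemma L2_Cauchy_Schwarz:
  assumes f: "f \<in> L2 M" and g: "g \<in> L2 M"
  shows "cmod (L2_inner M f g) \<le> L2_norm M f * L2_norm M g"
proof -
  have "ennreal (cmod (L2_inner M f g)) \<le> (\<integral>\<^sup>+x. ennreal (cmod (f x * cnj (g x))) \<partial>M)"
    unfolding L2_inner_def by (intro integral_norm_bound_ennreal L2_product_integrable f g)
  also have "\<dots> \<le> ennreal (L2_norm M f * L2_norm M g)"
    using L2_Cauchy_Schwarz_nn_integral[OF f g] by (simp add: norm_mult)
  finally show ?thesis by simp
qed

text \<open>
  A sigma-finite space carries a strictly positive square-integrable function. Multiples of it serve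
  below as cut-off levels in place of an exhaustion of the space by sets of finite measure.
\<close>

lemma (in sigma_finite_measure) exists_positive_L2_function:
  "\<exists>w. w \<in> borel_measurable M \<and> (\<forall>x\<in>space M. 0 < w x) \<and> (\<lambda>x. complex_of_real (w x)) \<in> L2 M"
proof -
  obtain h where [measurable]: "h \<in> borel_measurable M" and fin: "integral\<^sup>N M h \<noteq> \<infinity>"
    and h: "\<And>x. x \<in> space M \<Longrightarrow> 0 < h x \<and> h x < \<infinity>"
    using Ex_finite_integrable_function by blast
  have "(\<integral>\<^sup>+x. ennreal ((cmod (complex_of_real (sqrt (enn2real (h x)))))\<^sup>2) \<partial>M) = integral\<^sup>N M h"
    using h by (intro nn_integral_cong) (auto simp: less_top)
  then have "(\<lambda>x. complex_of_real (sqrt (enn2real (h x)))) \<in> L2 M"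
    using fin by (auto simp: L2_iff_nn_integral less_top)
  moreover have "0 < sqrt (enn2real (h x))" if "x \<in> space M" for x
    using h[OF that] by (simp add: enn2real_positive_iff)
  ultimately show ?thesis
    by (intro exI[of _ "\<lambda>x. sqrt (enn2real (h x))"]) auto
qed

text \<open>
  The truncations of a nonnegative function to the sets where it lies below a multiple of a
  square-integrable \<open>w\<close> are in L2, and if \<open>w\<close> is positive, bounds for the integrals of their
  squares carry over to the function itself.
\<close>

lemma L2_truncation:
  assumes "(\<lambda>x. complex_of_real (w x)) \<in> L2 M" and [measurable]: "(k :: 'a \<Rightarrow> real) \<in> borel_measurable M"
    "w \<in> borel_measurable M"
    and "\<And>x. x \<in> space M \<Longrightarrow> 0 \<le> k x"
  shows "(\<lambda>x. complex_of_real (k x * indicator {y. k y \<le> real n * w y} x)) \<in> L2 M"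
proof (rule L2_dominated[OF L2_scale[OF assms(1), of "of_nat n"]])
  show "cmod (complex_of_real (k x * indicator {y. k y \<le> real n * w y} x)) \<le> cmod (of_nat n * complex_of_real (w x))"
    if "x \<in> space M" for x
    using assms(4)[OF that] by (auto simp: indicator_def norm_mult abs_mult)
       (smt (verit) mult_left_mono of_nat_0_le_iff)
qed auto

lemma nn_integral_square_le_truncation:
  assumes [measurable]: "(k :: 'a \<Rightarrow> real) \<in> borel_measurable M" "w \<in> borel_measurable M"
    and w: "\<And>x. x \<in> space M \<Longrightarrow> 0 < w x"
    and le: "\<And>n. (\<integral>\<^sup>+x. ennreal ((k x * indicator {y. k y \<le> real n * w y} x)\<^sup>2) \<partial>M) \<le> B"
  shows "(\<integral>\<^sup>+x. ennreal ((k x)\<^sup>2) \<partial>M) \<le> B"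
proof -
  let ?t = "\<lambda>n x. ennreal ((k x * indicator {y. k y \<le> real n * w y} x)\<^sup>2)"
  have "(\<integral>\<^sup>+x. ennreal ((k x)\<^sup>2) \<partial>M) \<le> (\<integral>\<^sup>+x. liminf (\<lambda>n. ?t n x) \<partial>M)"
  proof (rule nn_integral_mono)
    fix x assume "x \<in> space M"
    have "eventually (\<lambda>n. k x \<le> real n * w x) sequentially"
      using w[OF \<open>x \<in> space M\<close>] by real_asymp
    then have "eventually (\<lambda>n. ennreal ((k x)\<^sup>2) \<le> ?t n x) sequentially"
      by eventually_elim simp
    then show "ennreal ((k x)\<^sup>2) \<le> liminf (\<lambda>n. ?t n x)"
      by (rule Liminf_bounded)
  qed
  also have "\<dots> \<le> liminf (\<lambda>n. \<integral>\<^sup>+x. ?t n x \<partial>M)"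
    by (rule nn_integral_liminf) measurable
  also have "\<dots> \<le> B"
    using le by (intro Liminf_le) auto
  finally show ?thesis .
qed

section \<open>Hyponormality as a norm inequality\<close>

lemma L2_bounded_operatorD:
  assumes "L2_bounded_operator M T"
  shows "f \<in> L2 M \<Longrightarrow> T f \<in> L2 M"
    and "\<exists>C\<ge>0. \<forall>f\<in>L2 M. L2_norm M (T f) \<le> C * L2_norm M f"
proof -
  show "f \<in> L2 M \<Longrightarrow> T f \<in> L2 M"
    using assms by (simp add: L2_bounded_operator_def)
  obtain C where C: "\<And>f. f \<in> L2 M \<Longrightarrow> L2_norm M (T f) \<le> C * L2_norm M f"
    using assms unfolding L2_bounded_operator_def by blast
  have "L2_norm M (T f) \<le> \<bar>C\<bar> * L2_norm M f" if "f \<in> L2 M" for f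
    using C[OF that] mult_right_mono[OF abs_ge_self[of C] L2_norm_nonneg[of M f]] by linarith
  then show "\<exists>C\<ge>0. \<forall>f\<in>L2 M. L2_norm M (T f) \<le> C * L2_norm M f"
    by (intro exI[of _ "\<bar>C\<bar>"]) simp
qed

lemma L2_operator_le_iff_norm_le:
  assumes T: "L2_bounded_operator M T" and S: "L2_is_adjoint M T S" and l: "l > 0"
  shows "L2_operator_le M (\<lambda>f x. complex_of_real (1 / l) * T (S f) x) (\<lambda>f. S (T f)) \<longleftrightarrow>
           (\<forall>f\<in>L2 M. (L2_norm M (S f))\<^sup>2 \<le> l * (L2_norm M (T f))\<^sup>2)"
proof -
  have "L2_inner M (\<lambda>x. S (T f) x - complex_of_real (1 / l) * T (S f) x) f =
      complex_of_real ((L2_norm M (T f))\<^sup>2 - (L2_norm M (S f))\<^sup>2 / l)" if f: "f \<in> L2 M" for f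
  proof -
    have in_L2: "T f \<in> L2 M" "S f \<in> L2 M" "S (T f) \<in> L2 M" "T (S f) \<in> L2 M"
      using f S L2_bounded_operatorD(1)[OF T] by (auto simp: L2_is_adjoint_def)
    have "L2_inner M (S (T f)) f = cnj (L2_inner M (T f) (T f))"
      using S f in_L2 by (subst L2_inner_cnj) (simp add: L2_is_adjoint_def)
    moreover have "L2_inner M (T (S f)) f = L2_inner M (S f) (S f)"
      using S f in_L2 by (simp add: L2_is_adjoint_def)
    ultimately show ?thesis
      unfolding L2_inner_diff_left[OF f in_L2(3) L2_scale[OF in_L2(4)]] L2_inner_scale_left
      by (simp add: L2_inner_self del: of_real_power)
  qed
  then have "L2_operator_le M (\<lambda>f x. complex_of_real (1 / l) * T (S f) x) (\<lambda>f. S (T f)) \<longleftrightarrow>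
      (\<forall>f\<in>L2 M. 0 \<le> (L2_norm M (T f))\<^sup>2 - (L2_norm M (S f))\<^sup>2 / l)"
    unfolding L2_operator_le_def L2_positive_def
    by (intro ball_cong refl) (simp only: nonneg_Reals_of_real_iff)
  then show ?thesis
    using l by (simp add: field_simps)
qed

section \<open>The adjoint of a weighted composition operator\<close>

text \<open>
  \<open>k\<close> is the value at \<open>f\<close> of an adjoint of \<open>T\<close>.
\<close>

definition adjoint_value ::
    "'a measure \<Rightarrow> (('a \<Rightarrow> complex) \<Rightarrow> 'a \<Rightarrow> complex) \<Rightarrow> ('a \<Rightarrow> complex) \<Rightarrow> ('a \<Rightarrow> complex) \<Rightarrow> bool"
  where "adjoint_value M T f k \<longleftrightarrow>
    k \<in> L2 M \<and> (\<forall>g\<in>L2 M. L2_inner M (T g) f = L2_inner M g k)"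

lemma adjoint_value_add:
  assumes "\<And>g. g \<in> L2 M \<Longrightarrow> T g \<in> L2 M" "f \<in> L2 M" "f' \<in> L2 M"
    and "adjoint_value M T f k" "adjoint_value M T f' k'"
  shows "adjoint_value M T (\<lambda>x. f x + f' x) (\<lambda>x. k x + k' x)"
  using assms by (simp add: adjoint_value_def L2_add L2_inner_add_right)

lemma adjoint_value_scale:
  assumes "adjoint_value M T f k"
  shows "adjoint_value M T (\<lambda>x. c * f x) (\<lambda>x. c * k x)"
  using assms by (simp add: adjoint_value_def L2_scale L2_inner_scale_right)

text \<open>
  The measure with density $h E(f)\circ\varphi^{-1}$ is the image under \<open>\<phi>\<close> of the measure with
  density \<open>f\<close>. This gives the next two change of variables formulas.
\<close>

lemma is_hE_nn_integral:
  assumes [measurable]: "\<phi> \<in> measurable M M" "f \<in> borel_measurable M" "G \<in> borel_measurable M"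
    and "is_hE M \<phi> f J"
  shows "(\<integral>\<^sup>+x. J x * G x \<partial>M) = (\<integral>\<^sup>+x. f x * G (\<phi> x) \<partial>M)"
proof -
  have [measurable]: "J \<in> borel_measurable M" and eq: "density M J = distr (density M f) M \<phi>"
    using assms(4) by (simp_all add: is_hE_iff_density)
  have m: "\<phi> \<in> measurable (density M f) M" by simp
  have "(\<integral>\<^sup>+x. J x * G x \<partial>M) = (\<integral>\<^sup>+x. G x \<partial>distr (density M f) M \<phi>)"
    by (simp add: eq[symmetric] nn_integral_density)
  also have "\<dots> = (\<integral>\<^sup>+x. f x * G (\<phi> x) \<partial>M)"
    by (simp add: nn_integral_distr[OF m] nn_integral_density)
  finally show ?thesis .
qed

lemma is_hE_integral:
  fixes f k :: "'a \<Rightarrow> real" and G :: "'a \<Rightarrow> complex"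
  assumes [measurable]: "\<phi> \<in> measurable M M" "f \<in> borel_measurable M" "k \<in> borel_measurable M"
      "G \<in> borel_measurable M"
    and f: "AE x in M. 0 \<le> f x" and k: "AE x in M. 0 \<le> k x"
    and hE: "is_hE M \<phi> (\<lambda>x. ennreal (f x)) (\<lambda>x. ennreal (k x))"
  shows "(\<integral>x. complex_of_real (k x) * G x \<partial>M) = (\<integral>x. complex_of_real (f x) * G (\<phi> x) \<partial>M)"
proof -
  have eq: "density M k = distr (density M f) M \<phi>"
    using hE by (simp add: is_hE_iff_density)
  have m: "\<phi> \<in> measurable (density M f) M" by simp
  have "(\<integral>x. complex_of_real (k x) * G x \<partial>M) = (\<integral>x. G x \<partial>distr (density M f) M \<phi>)"
    using k by (simp add: eq[symmetric] integral_density scaleR_conv_of_real)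
  also have "\<dots> = (\<integral>x. complex_of_real (f x) * G (\<phi> x) \<partial>M)"
    using f by (simp add: integral_distr[OF m] integral_density scaleR_conv_of_real)
  finally show ?thesis .
qed

text \<open>
  On a nonnegative \<open>v\<close> the adjoint is $h E(u v)\circ\varphi^{-1}$. Boundedness of the operator,
  applied to truncations of this function, shows that it is square-integrable.
\<close>

lemma wcomp_adjoint_value_nonneg:
  fixes v :: "'a \<Rightarrow> real"
  assumes sf: "sigma_finite_measure M" and ns: "nonsingular M \<phi>"
    and [measurable]: "u \<in> borel_measurable M" and u: "\<And>x. x \<in> space M \<Longrightarrow> 0 \<le> u x"
    and bd: "L2_bounded_operator M (wcomp u \<phi>)"
    and [measurable]: "v \<in> borel_measurable M" and v: "\<And>x. x \<in> space M \<Longrightarrow> 0 \<le> v x"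
    and v2: "(\<lambda>x. complex_of_real (v x)) \<in> L2 M" (is "?v \<in> _")
  shows "\<exists>k. adjoint_value M (wcomp u \<phi>) ?v k"
proof -
  have [measurable]: "\<phi> \<in> measurable M M"
    using ns by (simp add: nonsingular_def)
  have space: "\<phi> x \<in> space M" if "x \<in> space M" for x
    using measurable_space[of \<phi> M M] that by simp
  obtain w where [measurable]: "w \<in> borel_measurable M" and w: "\<And>x. x \<in> space M \<Longrightarrow> 0 < w x"
    and w2: "(\<lambda>x. complex_of_real (w x)) \<in> L2 M"
    using sigma_finite_measure.exists_positive_L2_function[OF sf] by blast
  obtain C where C: "C \<ge> 0" "\<And>f. f \<in> L2 M \<Longrightarrow> L2_norm M (wcomp u \<phi> f) \<le> C * L2_norm M f"
    using L2_bounded_operatorD(2)[OF bd] by blast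
  obtain K where K: "is_hE M \<phi> (\<lambda>x. ennreal (u x * v x)) K"
    using is_hE_exists[OF sf ns, of "\<lambda>x. ennreal (u x * v x)"] by auto
  then have [measurable]: "K \<in> borel_measurable M"
    by (simp add: is_hE_def)
  have K_le: "(\<integral>\<^sup>+x. K x * ennreal (g x) \<partial>M) \<le> ennreal (C * L2_norm M g * L2_norm M ?v)"
    if g: "(\<lambda>x. complex_of_real (g x)) \<in> L2 M" "\<And>x. x \<in> space M \<Longrightarrow> 0 \<le> g x"
      and [measurable]: "g \<in> borel_measurable M" for g :: "'a \<Rightarrow> real"
  proof -
    have "(\<integral>\<^sup>+x. K x * ennreal (g x) \<partial>M) = (\<integral>\<^sup>+x. ennreal (u x * v x) * ennreal (g (\<phi> x)) \<partial>M)"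
      by (rule is_hE_nn_integral[OF _ _ _ K]) measurable
    also have "\<dots> = (\<integral>\<^sup>+x. ennreal (cmod (wcomp u \<phi> g x) * cmod (?v x)) \<partial>M)"
      using u v g(2) space
      by (intro nn_integral_cong) (simp add: wcomp_def norm_mult ennreal_mult mult_ac)
    also have "\<dots> \<le> ennreal (L2_norm M (wcomp u \<phi> g) * L2_norm M ?v)"
      by (intro L2_Cauchy_Schwarz_nn_integral L2_bounded_operatorD[OF bd] g v2)
    also have "\<dots> \<le> ennreal (C * L2_norm M g * L2_norm M ?v)"
      by (intro ennreal_leI mult_right_mono C g) simp
    finally show ?thesis .
  qed
  \<comment> \<open>Pairing with the strictly positive \<open>w\<close> shows that \<open>K\<close> is finite almost everywhere.\<close>
  have "AE x in M. K x * ennreal (w x) \<noteq> \<infinity>"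
    using K_le[OF w2 less_imp_le[OF w]] by (intro nn_integral_noteq_infinite) (auto simp: top_unique)
  then have K_fin: "AE x in M. K x \<noteq> \<infinity>"
    using AE_space by eventually_elim (use w in \<open>force simp: ennreal_mult_eq_top_iff\<close>)
  define k where "k = (\<lambda>x. enn2real (K x))"
  have [measurable]: "k \<in> borel_measurable M" by (simp add: k_def)
  have k0: "0 \<le> k x" for x by (simp add: k_def)
  have kK: "AE x in M. ennreal (k x) = K x"
    using K_fin by eventually_elim (simp add: k_def less_top)
  have hE: "is_hE M \<phi> (\<lambda>x. ennreal (u x * v x)) (\<lambda>x. ennreal (k x))"
    using K density_cong[of "\<lambda>x. ennreal (k x)" M K, OF _ _ kK] by (simp add: is_hE_iff_density)
  have "(\<integral>\<^sup>+x. ennreal ((k x)\<^sup>2) \<partial>M) \<le> ennreal ((C * L2_norm M ?v)\<^sup>2)"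
  proof (rule nn_integral_square_le_truncation)
    fix n
    define t where "t = (\<lambda>x. k x * indicator {y. k y \<le> real n * w y} x)"
    have [measurable]: "t \<in> borel_measurable M"
      unfolding t_def by measurable
    have t2: "(\<lambda>x. complex_of_real (t x)) \<in> L2 M"
      unfolding t_def by (rule L2_truncation[OF w2]) (simp_all add: k0)
    \<comment> \<open>Since \<open>t\<^sup>2 = k t\<close>, the bound above reads \<open>\<parallel>t\<parallel>\<^sup>2 \<le> C \<parallel>t\<parallel> \<parallel>v\<parallel>\<close>, and \<open>\<parallel>t\<parallel>\<close> cancels.\<close>
    have t_norm: "ennreal ((L2_norm M t)\<^sup>2) = (\<integral>\<^sup>+x. ennreal ((t x)\<^sup>2) \<partial>M)"
      by (simp add: ennreal_L2_norm_sq t2)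
    also have "\<dots> = (\<integral>\<^sup>+x. K x * ennreal (t x) \<partial>M)"
      using kK by (intro nn_integral_cong_AE, eventually_elim)
        (auto simp: t_def indicator_def power2_eq_square ennreal_mult k0)
    also have "\<dots> \<le> ennreal (C * L2_norm M t * L2_norm M ?v)"
      by (rule K_le[OF t2]) (auto simp: t_def k0)
    finally have "L2_norm M t * L2_norm M t \<le> (C * L2_norm M ?v) * L2_norm M t"
      using C(1) by (simp add: power2_eq_square mult_ac)
    then have "L2_norm M t \<le> C * L2_norm M ?v"
      using C(1) by (cases "L2_norm M t = 0") (auto simp: mult_le_cancel_right less_le)
    then have "(L2_norm M t)\<^sup>2 \<le> (C * L2_norm M ?v)\<^sup>2"
      by (intro power_mono) auto
    then have "(\<integral>\<^sup>+x. ennreal ((t x)\<^sup>2) \<partial>M) \<le> ennreal ((C * L2_norm M ?v)\<^sup>2)"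
      unfolding t_norm[symmetric] by (rule ennreal_leI)
    then show "(\<integral>\<^sup>+x. ennreal ((k x * indicator {y. k y \<le> real n * w y} x)\<^sup>2) \<partial>M)
        \<le> ennreal ((C * L2_norm M ?v)\<^sup>2)"
      by (simp only: t_def)
  qed (use w in auto)
  then have k2: "(\<lambda>x. complex_of_real (k x)) \<in> L2 M"
    by (auto simp: L2_iff_nn_integral intro: le_less_trans)
  have "L2_inner M (wcomp u \<phi> g) ?v = L2_inner M g (\<lambda>x. complex_of_real (k x))" if "g \<in> L2 M" for g
    using is_hE_integral[of \<phi> M "\<lambda>x. u x * v x" k g] u v k0 hE L2_measurable[OF that]
    by (simp add: L2_inner_def wcomp_def mult_ac)
  then show ?thesis
    using k2 by (auto simp: adjoint_value_def)
qed

text \<open>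
  Any function is a linear combination of the positive and negative parts of its real and
  imaginary parts.
\<close>

lemma wcomp_adjoint_exists:
  assumes sf: "sigma_finite_measure M" and ns: "nonsingular M \<phi>"
    and u: "u \<in> borel_measurable M" "\<And>x. x \<in> space M \<Longrightarrow> 0 \<le> u x"
    and bd: "L2_bounded_operator M (wcomp u \<phi>)"
  shows "\<exists>S. L2_is_adjoint M (wcomp u \<phi>) S"
proof -
  let ?W = "wcomp u \<phi>"
  have "\<exists>k. adjoint_value M ?W f k" if f: "f \<in> L2 M" for f
  proof -
    have [measurable]: "f \<in> borel_measurable M"
      using f by (rule L2_measurable)
    define p where "p = (\<lambda>(r :: complex \<Rightarrow> real) x. complex_of_real (max (r (f x)) 0))"
    have part: "p r \<in> L2 M \<and> (\<exists>k. adjoint_value M ?W (p r) k)"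
      if [measurable]: "r \<in> borel_measurable borel" and "\<And>z. r z \<le> cmod z" for r
    proof -
      have "p r \<in> L2 M"
        unfolding p_def by (rule L2_dominated[OF f]) (use that(2) in auto)
      then show ?thesis
        using wcomp_adjoint_value_nonneg[OF sf ns u bd, of "\<lambda>x. max (r (f x)) 0"]
        by (auto simp: p_def)
    qed
    have parts: "p Re \<in> L2 M \<and> (\<exists>k. adjoint_value M ?W (p Re) k)"
      "p (\<lambda>z. - Re z) \<in> L2 M \<and> (\<exists>k. adjoint_value M ?W (p (\<lambda>z. - Re z)) k)"
      "p Im \<in> L2 M \<and> (\<exists>k. adjoint_value M ?W (p Im) k)"
      "p (\<lambda>z. - Im z) \<in> L2 M \<and> (\<exists>k. adjoint_value M ?W (p (\<lambda>z. - Im z)) k)"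
      using abs_Re_le_cmod abs_Im_le_cmod by (intro part; force simp: abs_le_iff)+
    then obtain k1 k2 k3 k4 where k: "adjoint_value M ?W (p Re) k1"
      "adjoint_value M ?W (p (\<lambda>z. - Re z)) k2" "adjoint_value M ?W (p Im) k3"
      "adjoint_value M ?W (p (\<lambda>z. - Im z)) k4"
      by blast
    note W = L2_bounded_operatorD(1)[OF bd]
    have "adjoint_value M ?W
        (\<lambda>x. (p Re x + (- 1) * p (\<lambda>z. - Re z) x) + (\<i> * p Im x + (- \<i>) * p (\<lambda>z. - Im z) x))
        (\<lambda>x. (k1 x + (- 1) * k2 x) + (\<i> * k3 x + (- \<i>) * k4 x))"
      using parts by (intro adjoint_value_add adjoint_value_scale L2_add L2_scale W k) auto
    moreover have "(\<lambda>x. (p Re x + (- 1) * p (\<lambda>z. - Re z) x)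
        + (\<i> * p Im x + (- \<i>) * p (\<lambda>z. - Im z) x)) = f"
      by (rule ext) (auto simp: p_def complex_eq_iff max_def)
    ultimately show ?thesis by auto
  qed
  then obtain S where "\<And>f. f \<in> L2 M \<Longrightarrow> adjoint_value M ?W f (S f)"
    by metis
  then show ?thesis
    by (intro exI[of _ S]) (simp add: L2_is_adjoint_def adjoint_value_def)
qed

section \<open>Closed range bounds the density away from zero\<close>

lemma wcomp_nn_integral_norm:
  assumes [measurable]: "\<phi> \<in> measurable M M" "u \<in> borel_measurable M" "f \<in> borel_measurable M"
    and J: "is_hE M \<phi> (\<lambda>x. ennreal (\<bar>u x\<bar>\<^sup>2)) J"
  shows "(\<integral>\<^sup>+x. ennreal ((cmod (wcomp u \<phi> f x))\<^sup>2) \<partial>M) = (\<integral>\<^sup>+x. J x * ennreal ((cmod (f x))\<^sup>2) \<partial>M)"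
proof -
  have "(\<integral>\<^sup>+x. J x * ennreal ((cmod (f x))\<^sup>2) \<partial>M)
      = (\<integral>\<^sup>+x. ennreal (\<bar>u x\<bar>\<^sup>2) * ennreal ((cmod (f (\<phi> x)))\<^sup>2) \<partial>M)"
    by (rule is_hE_nn_integral[OF _ _ _ J]) measurable
  then show ?thesis
    by (simp add: wcomp_def norm_mult power_mult_distrib ennreal_mult)
qed

text \<open>
  If the integral of \<open>J f\<^sup>2\<close> is finite, the image of \<open>f\<close> is a limit of images of truncations
  of \<open>f\<close>, hence the image of a square-integrable function as the range is closed. That function agrees with \<open>f\<close>
  where \<open>J\<close> does not vanish.
\<close>

lemma wcomp_closed_range_square_integrable:
  fixes f :: "'a \<Rightarrow> real"
  assumes sf: "sigma_finite_measure M" and \<phi> [measurable]: "\<phi> \<in> measurable M M"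
    and [measurable]: "u \<in> borel_measurable M"
    and J: "is_hE M \<phi> (\<lambda>x. ennreal (\<bar>u x\<bar>\<^sup>2)) J"
    and bd: "L2_bounded_operator M (wcomp u \<phi>)"
    and cr: "L2_closed_range M (wcomp u \<phi>)"
    and [measurable]: "f \<in> borel_measurable M" and f: "\<And>x. x \<in> space M \<Longrightarrow> 0 \<le> f x"
    and f0: "\<And>x. x \<in> space M \<Longrightarrow> J x = 0 \<Longrightarrow> f x = 0"
    and fin: "(\<integral>\<^sup>+x. J x * ennreal ((f x)\<^sup>2) \<partial>M) < \<infinity>"
  shows "(\<integral>\<^sup>+x. ennreal ((f x)\<^sup>2) \<partial>M) < \<infinity>"
proof -
  have [measurable]: "J \<in> borel_measurable M"
    using J by (simp add: is_hE_def)
  obtain w where [measurable]: "w \<in> borel_measurable M" and w: "\<And>x. x \<in> space M \<Longrightarrow> 0 < w x"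
    and w2: "(\<lambda>x. complex_of_real (w x)) \<in> L2 M"
    using sigma_finite_measure.exists_positive_L2_function[OF sf] by blast
  define F where "F = (\<lambda>n x. complex_of_real (f x * indicator {y. f y \<le> real n * w y} x))"
  have F2: "F n \<in> L2 M" for n
    unfolding F_def by (rule L2_truncation[OF w2]) (simp_all add: f)
  let ?g = "wcomp u \<phi> (\<lambda>x. complex_of_real (f x))"
  have [measurable]: "?g \<in> borel_measurable M"
    unfolding wcomp_def by measurable
  have g2: "?g \<in> L2 M"
    using fin by (simp add: L2_iff_nn_integral wcomp_nn_integral_norm[OF _ _ _ J])
  have "(\<lambda>n. \<integral>x. (cmod (wcomp u \<phi> (F n) x - ?g x))\<^sup>2 \<partial>M) \<longlonglongrightarrow> (\<integral>x. 0 \<partial>M)"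
  proof (rule integral_dominated_convergence[where w = "\<lambda>x. (cmod (?g x))\<^sup>2"])
    show "integrable M (\<lambda>x. (cmod (?g x))\<^sup>2)"
      using g2 by (simp add: L2_def)
    show "AE x in M. (\<lambda>n. (cmod (wcomp u \<phi> (F n) x - ?g x))\<^sup>2) \<longlonglongrightarrow> 0"
    proof (rule AE_I2)
      fix x assume "x \<in> space M"
      then have "0 < w (\<phi> x)"
        using w measurable_space[OF \<phi>] by blast
      then have "eventually (\<lambda>n. f (\<phi> x) \<le> real n * w (\<phi> x)) sequentially"
        by real_asymp
      then have "eventually (\<lambda>n. (cmod (wcomp u \<phi> (F n) x - ?g x))\<^sup>2 = 0) sequentially"
        by eventually_elim (simp add: wcomp_def F_def)
      then show "(\<lambda>n. (cmod (wcomp u \<phi> (F n) x - ?g x))\<^sup>2) \<longlonglongrightarrow> 0"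
        by (rule tendsto_eventually)
    qed
    show "AE x in M. norm ((cmod (wcomp u \<phi> (F n) x - ?g x))\<^sup>2) \<le> (cmod (?g x))\<^sup>2" for n
      by (auto simp: wcomp_def F_def indicator_def)
    show "(\<lambda>x. (cmod (wcomp u \<phi> (F n) x - ?g x))\<^sup>2) \<in> borel_measurable M" for n
      unfolding wcomp_def F_def by measurable
  qed simp
  then have "(\<lambda>n. L2_norm M (\<lambda>x. wcomp u \<phi> (F n) x - ?g x)) \<longlonglongrightarrow> 0"
    unfolding L2_norm_def using tendsto_real_sqrt by fastforce
  then obtain k where k: "k \<in> L2 M" and kg: "AE x in M. wcomp u \<phi> k x = ?g x"
    using cr F2 g2 unfolding L2_closed_range_def by blast
  have [measurable]: "k \<in> borel_measurable M"
    using k by (rule L2_measurable)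
  have "(\<integral>\<^sup>+x. J x * ennreal ((cmod (k x - complex_of_real (f x)))\<^sup>2) \<partial>M)
      = (\<integral>\<^sup>+x. ennreal ((cmod (wcomp u \<phi> (\<lambda>x. k x - complex_of_real (f x)) x))\<^sup>2) \<partial>M)"
    by (rule wcomp_nn_integral_norm[OF _ _ _ J, symmetric]) measurable
  also have "\<dots> = (\<integral>\<^sup>+x. 0 \<partial>M)"
    using kg by (intro nn_integral_cong_AE, eventually_elim) (simp add: wcomp_def right_diff_distrib)
  finally have "AE x in M. J x * ennreal ((cmod (k x - complex_of_real (f x)))\<^sup>2) = 0"
    by (simp add: nn_integral_0_iff_AE)
  then have "AE x in M. ennreal ((f x)\<^sup>2) \<le> ennreal ((cmod (k x))\<^sup>2)"
    using AE_space by eventually_elim (auto simp: f0 ennreal_eq_0_iff)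
  then have "(\<integral>\<^sup>+x. ennreal ((f x)\<^sup>2) \<partial>M) \<le> (\<integral>\<^sup>+x. ennreal ((cmod (k x))\<^sup>2) \<partial>M)"
    by (rule nn_integral_mono_AE)
  then show ?thesis
    using k by (auto simp: L2_iff_nn_integral intro: le_less_trans)
qed

text \<open>
  If \<open>J\<close> is not bounded below on its support, each set \<open>{0 < J < (1/2) ^ n}\<close> has positive measure.
  Let \<open>w\<close> be positive and square-integrable; normalizing \<open>w\<^sup>2\<close> on each of these sets and summing gives a function that is not integrable although its product with \<open>J\<close> is.
\<close>

lemma wcomp_closed_range_bounded_below:
  assumes sf: "sigma_finite_measure M" and [measurable]: "\<phi> \<in> measurable M M"
    and [measurable]: "u \<in> borel_measurable M"
    and J: "is_hE M \<phi> (\<lambda>x. ennreal (\<bar>u x\<bar>\<^sup>2)) J"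
    and bd: "L2_bounded_operator M (wcomp u \<phi>)"
    and cr: "L2_closed_range M (wcomp u \<phi>)"
  shows "\<exists>c>0. AE x in M. J x \<noteq> 0 \<longrightarrow> ennreal c \<le> J x"
proof (rule ccontr)
  assume "\<not> ?thesis"
  then have not_AE: "\<not> (AE x in M. J x \<noteq> 0 \<longrightarrow> ennreal ((1/2) ^ n) \<le> J x)" for n :: nat
    by (metis zero_less_divide_1_iff zero_less_numeral zero_less_power)
  have [measurable]: "J \<in> borel_measurable M"
    using J by (simp add: is_hE_def)
  obtain w where [measurable]: "w \<in> borel_measurable M" and w: "\<And>x. x \<in> space M \<Longrightarrow> 0 < w x"
    and w2: "(\<lambda>x. complex_of_real (w x)) \<in> L2 M"
    using sigma_finite_measure.exists_positive_L2_function[OF sf] by blast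
  define D where "D = (\<lambda>n::nat. {x \<in> space M. J x \<noteq> 0 \<and> J x < ennreal ((1/2) ^ n)})"
  have [measurable]: "D n \<in> sets M" for n
    unfolding D_def by measurable
  define a where "a = (\<lambda>n. \<integral>\<^sup>+x. ennreal ((w x)\<^sup>2) * indicator (D n) x \<partial>M)"
  have a0: "a n \<noteq> 0" for n
  proof
    assume "a n = 0"
    then have "AE x in M. ennreal ((w x)\<^sup>2) * indicator (D n) x = 0"
      by (simp add: a_def nn_integral_0_iff_AE)
    then have "AE x in M. J x \<noteq> 0 \<longrightarrow> ennreal ((1/2) ^ n) \<le> J x"
      using AE_space by eventually_elim (use w in \<open>force simp: D_def indicator_def not_less\<close>)
    then show False using not_AE by blast
  qed
  have "a n \<le> (\<integral>\<^sup>+x. ennreal ((cmod (complex_of_real (w x)))\<^sup>2) \<partial>M)" for n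
    unfolding a_def by (intro nn_integral_mono) (simp add: indicator_def)
  then have a_fin: "a n < \<infinity>" for n
    using w2 by (auto simp: L2_iff_nn_integral intro: le_less_trans)
  have a1: "a n / a n = 1" for n
    using a0[of n] a_fin[of n] by (simp add: ennreal_divide_self less_top)
  define F where "F = (\<lambda>x. \<Sum>n. ennreal ((w x)\<^sup>2) * indicator (D n) x / a n)"
  have [measurable]: "F \<in> borel_measurable M"
    unfolding F_def by measurable
  have "(\<integral>\<^sup>+x. F x \<partial>M) = (\<Sum>n. a n / a n)"
    unfolding F_def a_def by (simp add: nn_integral_suminf nn_integral_divide)
  moreover have "(\<Sum>n::nat. ennreal 1) = top"
    using summable_suminf_not_top[of "\<lambda>_. 1"] by (auto simp: summable_const_iff)
  ultimately have F_inf: "(\<integral>\<^sup>+x. F x \<partial>M) = \<infinity>"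
    by (simp add: a1)
  have "(\<integral>\<^sup>+x. J x * F x \<partial>M) = (\<integral>\<^sup>+x. (\<Sum>n. J x * (ennreal ((w x)\<^sup>2) * indicator (D n) x / a n)) \<partial>M)"
    unfolding F_def by simp
  also have "\<dots> \<le> (\<integral>\<^sup>+x. (\<Sum>n. ennreal ((1/2) ^ n) * (ennreal ((w x)\<^sup>2) * indicator (D n) x / a n)) \<partial>M)"
    by (intro nn_integral_mono suminf_le) (auto simp: D_def indicator_def intro!: mult_right_mono)
  also have "\<dots> = (\<Sum>n. ennreal ((1/2) ^ n) * (a n / a n))"
    unfolding a_def by (simp add: nn_integral_suminf nn_integral_cmult nn_integral_divide)
  also have "\<dots> = ennreal (\<Sum>n. (1/2) ^ n)"
    by (simp only: a1 mult_1_right, intro suminf_ennreal2) (auto intro: summable_geometric)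
  finally have JF: "(\<integral>\<^sup>+x. J x * F x \<partial>M) < \<infinity>"
    by (rule le_less_trans) simp
  have F0: "F x = 0" if "J x = 0" for x
    using that by (simp add: F_def D_def)
  have "AE x in M. J x * F x \<noteq> \<infinity>"
    using JF by (intro nn_integral_noteq_infinite) auto
  then have F_fin: "AE x in M. ennreal ((sqrt (enn2real (F x)))\<^sup>2) = F x"
    by eventually_elim (auto simp: ennreal_mult_eq_top_iff F0 less_top)
  have "(\<integral>\<^sup>+x. ennreal ((sqrt (enn2real (F x)))\<^sup>2) \<partial>M) < \<infinity>"
  proof (rule wcomp_closed_range_square_integrable[OF sf _ _ J bd cr])
    have "(\<integral>\<^sup>+x. J x * ennreal ((sqrt (enn2real (F x)))\<^sup>2) \<partial>M) = (\<integral>\<^sup>+x. J x * F x \<partial>M)"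
      using F_fin by (intro nn_integral_cong_AE, eventually_elim) simp
    then show "(\<integral>\<^sup>+x. J x * ennreal ((sqrt (enn2real (F x)))\<^sup>2) \<partial>M) < \<infinity>"
      using JF by simp
  qed (simp_all add: F0)
  moreover have "(\<integral>\<^sup>+x. ennreal ((sqrt (enn2real (F x)))\<^sup>2) \<partial>M) = (\<integral>\<^sup>+x. F x \<partial>M)"
    by (rule nn_integral_cong_AE[OF F_fin])
  ultimately show False
    using F_inf by simp
qed

section \<open>Hyponormality and supports\<close>

text \<open>
  A hyponormal operator has its kernel inside the kernel of its adjoint. A strictly positive
  square-integrable \<open>w\<close>, restricted to the zeros of \<open>J\<close>, lies in the kernel of the operator and is
  therefore orthogonal to the image of \<open>w\<close>; the inner product has a nonnegative integrand.
\<close>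

lemma wcomp_hyponormal_imp_AE_subset:
  assumes sf: "sigma_finite_measure M" and [measurable]: "\<phi> \<in> measurable M M"
    and [measurable]: "u \<in> borel_measurable M" and u: "\<And>x. x \<in> space M \<Longrightarrow> 0 \<le> u x"
    and J: "is_hE M \<phi> (\<lambda>x. ennreal (\<bar>u x\<bar>\<^sup>2)) J"
    and bd: "L2_bounded_operator M (wcomp u \<phi>)"
    and l: "l > 0" and hyp: "lambda_hyponormal M l (wcomp u \<phi>)"
  shows "AE_subset M (supp M u) (supp M J)"
proof -
  let ?W = "wcomp u \<phi>"
  have [measurable]: "J \<in> borel_measurable M"
    using J by (simp add: is_hE_def)
  obtain w where [measurable]: "w \<in> borel_measurable M" and w: "\<And>x. x \<in> space M \<Longrightarrow> 0 < w x"
    and w2: "(\<lambda>x. complex_of_real (w x)) \<in> L2 M" (is "?w \<in> _")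
    using sigma_finite_measure.exists_positive_L2_function[OF sf] by blast
  obtain S where S: "L2_is_adjoint M ?W S"
    and S_le: "\<And>f. f \<in> L2 M \<Longrightarrow> (L2_norm M (S f))\<^sup>2 \<le> l * (L2_norm M (?W f))\<^sup>2"
    using hyp L2_operator_le_iff_norm_le[OF bd _ l] unfolding lambda_hyponormal_def by blast
  define f where "f = (\<lambda>x. complex_of_real (w x * indicator {y. J y = 0} x))"
  have [measurable]: "f \<in> borel_measurable M"
    unfolding f_def by measurable
  have f: "f \<in> L2 M"
    by (rule L2_dominated[OF w2]) (auto simp: f_def indicator_def)
  have "ennreal ((L2_norm M (?W f))\<^sup>2) = (\<integral>\<^sup>+x. J x * ennreal ((cmod (f x))\<^sup>2) \<partial>M)"
    by (simp add: ennreal_L2_norm_sq L2_bounded_operatorD(1)[OF bd] f wcomp_nn_integral_norm[OF _ _ _ J])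
  also have "\<dots> = (\<integral>\<^sup>+x. 0 \<partial>M)"
    by (intro nn_integral_cong) (auto simp: f_def indicator_def)
  finally have "L2_norm M (?W f) = 0"
    by simp
  then have "L2_norm M (S f) = 0"
    using S_le[OF f] by simp
  moreover have "cmod (L2_inner M ?w (S f)) \<le> L2_norm M ?w * L2_norm M (S f)"
    using S f by (intro L2_Cauchy_Schwarz w2) (simp add: L2_is_adjoint_def)
  ultimately have "L2_inner M (?W ?w) f = 0"
    using S f w2 by (simp add: L2_is_adjoint_def)
  moreover define p where "p = (\<lambda>x. u x * w (\<phi> x) * (w x * indicator {y. J y = 0} x))"
  have p_eq: "?W ?w x * cnj (f x) = complex_of_real (p x)" for x
    by (simp add: wcomp_def f_def p_def)
  ultimately have "(\<integral>x. p x \<partial>M) = 0"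
    by (simp add: L2_inner_def)
  moreover have "integrable M p"
    using L2_product_integrable[OF L2_bounded_operatorD(1)[OF bd w2] f]
    by (simp add: p_eq complex_of_real_integrable_eq)
  moreover have space: "\<phi> x \<in> space M" if "x \<in> space M" for x
    using measurable_space[of \<phi> M M] that by simp
  then have "0 \<le> p x" if "x \<in> space M" for x
    using that u[of x] w[of x] w[of "\<phi> x"] by (simp add: p_def)
  ultimately have "AE x in M. p x = 0"
    by (subst integral_nonneg_eq_0_iff_AE[symmetric]) auto
  then show ?thesis
    unfolding AE_subset_def supp_def using AE_space
  proof eventually_elim
    case (elim x)
    then show ?case
      using w[of x] w[OF space[of x]] by (auto simp: p_def indicator_def)
  qed
qed

text \<open>
  The range of the operator consists of functions that vanish off \<open>supp M u\<close>. So the adjoint only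
  sees the restriction of a function to \<open>supp M u\<close>, hence to \<open>supp M J\<close>, and there the operator is
  bounded below.
\<close>

lemma AE_subset_imp_wcomp_hyponormal:
  assumes sf: "sigma_finite_measure M" and ns: "nonsingular M \<phi>"
    and [measurable]: "u \<in> borel_measurable M" and u: "\<And>x. x \<in> space M \<Longrightarrow> 0 \<le> u x"
    and J: "is_hE M \<phi> (\<lambda>x. ennreal (\<bar>u x\<bar>\<^sup>2)) J"
    and bd: "L2_bounded_operator M (wcomp u \<phi>)"
    and cr: "L2_closed_range M (wcomp u \<phi>)"
    and sub: "AE_subset M (supp M u) (supp M J)"
  shows "\<exists>l>0. lambda_hyponormal M l (wcomp u \<phi>)"
proof -
  let ?W = "wcomp u \<phi>"
  have [measurable]: "\<phi> \<in> measurable M M"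
    using ns by (simp add: nonsingular_def)
  have [measurable]: "J \<in> borel_measurable M"
    using J by (simp add: is_hE_def)
  obtain c where c: "c > 0" "AE x in M. J x \<noteq> 0 \<longrightarrow> ennreal c \<le> J x"
    using wcomp_closed_range_bounded_below[OF sf _ _ J bd cr] by auto
  obtain C where C: "C \<ge> 0" "\<And>f. f \<in> L2 M \<Longrightarrow> L2_norm M (?W f) \<le> C * L2_norm M f"
    using L2_bounded_operatorD(2)[OF bd] by blast
  obtain S where S: "L2_is_adjoint M ?W S"
    using wcomp_adjoint_exists[OF sf ns _ u bd] by auto
  \<comment> \<open>The summand 1 makes the constant positive when \<open>C = 0\<close>.\<close>
  define l where "l = (C\<^sup>2 + 1) / c"
  have l: "l > 0"
    using c(1) by (simp add: l_def add_nonneg_pos)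
  have "(L2_norm M (S f))\<^sup>2 \<le> l * (L2_norm M (?W f))\<^sup>2" if f: "f \<in> L2 M" for f
  proof -
    have [measurable]: "f \<in> borel_measurable M"
      using f by (rule L2_measurable)
    define f' where "f' = (\<lambda>x. f x * indicator {y. u y \<noteq> 0} x)"
    have [measurable]: "f' \<in> borel_measurable M"
      unfolding f'_def by measurable
    have f': "f' \<in> L2 M"
      by (rule L2_dominated[OF f]) (auto simp: f'_def indicator_def)
    have Sf: "S f \<in> L2 M" "?W (S f) \<in> L2 M" "?W f \<in> L2 M"
      using S f L2_bounded_operatorD(1)[OF bd] by (auto simp: L2_is_adjoint_def)
    have "complex_of_real ((L2_norm M (S f))\<^sup>2) = L2_inner M (?W (S f)) f"
      using S f Sf by (simp add: L2_is_adjoint_def L2_inner_self)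
    also have "\<dots> = L2_inner M (?W (S f)) f'"
      unfolding L2_inner_def
      by (intro Bochner_Integration.integral_cong) (auto simp: wcomp_def f'_def indicator_def)
    finally have "(L2_norm M (S f))\<^sup>2 = cmod (L2_inner M (?W (S f)) f')"
      by (metis abs_of_nonneg norm_of_real zero_le_power2)
    also have "\<dots> \<le> L2_norm M (?W (S f)) * L2_norm M f'"
      by (rule L2_Cauchy_Schwarz[OF Sf(2) f'])
    also have "\<dots> \<le> C * L2_norm M (S f) * L2_norm M f'"
      by (intro mult_right_mono C Sf) simp
    finally have "L2_norm M (S f) * L2_norm M (S f) \<le> (C * L2_norm M f') * L2_norm M (S f)"
      by (simp add: power2_eq_square mult_ac)
    then have "L2_norm M (S f) \<le> C * L2_norm M f'"
      using C(1) by (cases "L2_norm M (S f) = 0") (auto simp: mult_le_cancel_right less_le)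
    then have "(L2_norm M (S f))\<^sup>2 \<le> (C * L2_norm M f')\<^sup>2"
      by (intro power_mono) auto
    also have "\<dots> \<le> (C\<^sup>2 + 1) * (L2_norm M f')\<^sup>2"
      by (simp add: power_mult_distrib mult_right_mono)
    finally have 1: "(L2_norm M (S f))\<^sup>2 \<le> (C\<^sup>2 + 1) * (L2_norm M f')\<^sup>2" .
    have "ennreal (c * (L2_norm M f')\<^sup>2) = (\<integral>\<^sup>+x. ennreal c * ennreal ((cmod (f' x))\<^sup>2) \<partial>M)"
      using c(1) by (simp add: ennreal_mult ennreal_L2_norm_sq f' nn_integral_cmult)
    also have "\<dots> \<le> (\<integral>\<^sup>+x. J x * ennreal ((cmod (f x))\<^sup>2) \<partial>M)"
    proof (rule nn_integral_mono_AE)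
      show "AE x in M. ennreal c * ennreal ((cmod (f' x))\<^sup>2) \<le> J x * ennreal ((cmod (f x))\<^sup>2)"
        using c(2) sub[unfolded AE_subset_def] AE_space
        by eventually_elim (auto simp: supp_def f'_def indicator_def intro!: mult_right_mono)
    qed
    also have "\<dots> = ennreal ((L2_norm M (?W f))\<^sup>2)"
      by (simp add: ennreal_L2_norm_sq Sf wcomp_nn_integral_norm[OF _ _ _ J])
    finally have "c * (L2_norm M f')\<^sup>2 \<le> (L2_norm M (?W f))\<^sup>2"
      by simp
    then have "(L2_norm M f')\<^sup>2 \<le> (L2_norm M (?W f))\<^sup>2 / c"
      using c(1) by (simp add: field_simps)
    then have "(C\<^sup>2 + 1) * (L2_norm M f')\<^sup>2 \<le> (C\<^sup>2 + 1) * ((L2_norm M (?W f))\<^sup>2 / c)"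
      by (intro mult_left_mono) auto
    then show ?thesis
      using 1 by (simp add: l_def)
  qed
  then show ?thesis
    using l S L2_operator_le_iff_norm_le[OF bd S l] unfolding lambda_hyponormal_def by blast
qed

theorem theorem3p4:
  fixes M :: "'a measure" and \<phi> :: "'a \<Rightarrow> 'a" and u :: "'a \<Rightarrow> real" and J :: "'a \<Rightarrow> ennreal"
  assumes "sigma_finite_measure M"
    and "nonsingular M \<phi>"
    and "u \<in> borel_measurable M" and "\<And>x. x \<in> space M \<Longrightarrow> 0 \<le> u x"
    and "is_hE M \<phi> (\<lambda>x. ennreal (\<bar>u x\<bar>\<^sup>2)) J"
    and "L2_bounded_operator M (wcomp u \<phi>)"
    and "L2_closed_range M (wcomp u \<phi>)"
  shows "(\<exists>l>0. lambda_hyponormal M l (wcomp u \<phi>)) \<longleftrightarrow> AE_subset M (supp M u) (supp M J)"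
proof
  have "\<phi> \<in> measurable M M"
    using assms(2) by (simp add: nonsingular_def)
  then show "AE_subset M (supp M u) (supp M J)" if "\<exists>l>0. lambda_hyponormal M l (wcomp u \<phi>)"
    using that wcomp_hyponormal_imp_AE_subset[OF assms(1) _ assms(3,4,5,6)] by blast
  show "\<exists>l>0. lambda_hyponormal M l (wcomp u \<phi>)" if "AE_subset M (supp M u) (supp M J)"
    using AE_subset_imp_wcomp_hyponormal[OF assms that] .
qed

end
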